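(* A DFS traversal of an undirected graph $G$ with $n$ vertices and $m$ edges can be performed in $O(n+m)$ time using $4m+(\lg 3+2)n+o(m+n)$ bits of working space.
   Context: Model: the input graph is in read-only memory as an adjacency list with cross pointers: given a vertex $u$ and the position in its list of a neighbour $v$, there is a pointer to the position of $u$ in the list of $v$. Output goes to write-only memory and only additional workspace is counted, in bits, on a word RAM with words of $\Omega(\lg n)$ bits. As a standing assumption of the paper, the input graph is connected, so $m\ge n-1$. *)

theory Defs
  imports Complex_Main "HOL-Library.Landau_Symbols" "HOL-Library.Monad_Syntax"
begin

definition simple_graph :: "nat \<Rightarrow> nat set set \<Rightarrow> bool" where
  "simple_graph n E \<longleftrightarrow> E \<subseteq> {{u, v} | u v. u < n \<and> v < n \<and> u \<noteq> v}"

definition connected_graph :: "nat \<Rightarrow> nat set set \<Rightarrow> bool" where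
  "connected_graph n E \<longleftrightarrow>
     0 < n \<and> (\<forall>u<n. \<forall>v<n. (u, v) \<in> {(x, y). {x, y} \<in> E}\<^sup>*)"

datatype event = Visit nat | Leave nat

text \<open>In \<open>dfs_from E p S es\<close> the list \<open>p\<close> is the current path (deepest vertex first), \<open>S\<close> is the
  set of vertices visited so far, and \<open>es\<close> is what remains of the traversal. The choice among the
  unvisited neighbours is free; a vertex may be left only when it has no unvisited neighbour.\<close>

inductive dfs_from :: "nat set set \<Rightarrow> nat list \<Rightarrow> nat set \<Rightarrow> event list \<Rightarrow> bool"
  for E :: "nat set set" where
  finish: "dfs_from E [] S []"
| advance: "{u, v} \<in> E \<Longrightarrow> v \<notin> S \<Longrightarrow> dfs_from E (v # u # p) (insert v S) es \<Longrightarrow>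
    dfs_from E (u # p) S (Visit v # es)"
| retreat: "(\<And>v. {u, v} \<in> E \<Longrightarrow> v \<in> S) \<Longrightarrow> dfs_from E p S es \<Longrightarrow>
    dfs_from E (u # p) S (Leave u # es)"

text \<open>Only one root is used, so this is a traversal of the whole graph only if it is connected.\<close>

definition dfs_traversal :: "nat \<Rightarrow> nat set set \<Rightarrow> event list \<Rightarrow> bool" where
  "dfs_traversal n E es \<longleftrightarrow> (\<exists>s<n. \<exists>es'. es = Visit s # es' \<and> dfs_from E [s] {s} es')"

fun event_words :: "event \<Rightarrow> nat list" where
  "event_words (Visit v) = [0, v]"
| "event_words (Leave v) = [1, v]"

text \<open>If \<open>u\<close> is at position \<open>i\<close> of the list of \<open>v\<close>, then the entry \<open>i\<close> of \<open>cross_ptrs\<close> for \<open>v\<close>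
  is the position of \<open>v\<close> in the list of \<open>u\<close>.\<close>

record input =
  adj_lists :: "nat list list"
  cross_ptrs :: "nat list list"

definition represents :: "input \<Rightarrow> nat \<Rightarrow> nat set set \<Rightarrow> bool" where
  "represents I n E \<longleftrightarrow>
     length (adj_lists I) = n \<and> length (cross_ptrs I) = n \<and>
     (\<forall>v<n. distinct (adj_lists I ! v) \<and> set (adj_lists I ! v) = {u. {v, u} \<in> E} \<and>
        length (cross_ptrs I ! v) = length (adj_lists I ! v) \<and>
        (\<forall>i<length (adj_lists I ! v).
           let u = adj_lists I ! v ! i; j = cross_ptrs I ! v ! i
           in j < length (adj_lists I ! u) \<and> adj_lists I ! u ! j = v))"

text \<open>There are no registers besides the working memory: every word that a program can modify
  and read again is a memory cell, and hence is counted as working space.\<close>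

datatype loc = Cell nat | Deref nat

datatype operand = Const nat | At loc

datatype binop = Add | Sub | Mul | Div | Mod | And | Or | Xor | Shl | Shr

datatype instr =
    Compute loc binop operand operand
  | Num_Vertices loc
  | Neighbour loc operand operand
  | Cross loc operand operand
  | Output operand
  | Branch_Less operand operand nat
  | Branch_Eq operand operand nat
  | Halt

text \<open>The result is later reduced modulo \<open>2 ^ w\<close>; both arguments are below \<open>2 ^ w\<close>, which makes
  \<open>Sub\<close> subtraction modulo \<open>2 ^ w\<close>.\<close>

fun binop_value :: "nat \<Rightarrow> binop \<Rightarrow> nat \<Rightarrow> nat \<Rightarrow> nat" where
  "binop_value w Add x y = x + y"
| "binop_value w Sub x y = x + 2 ^ w - y"
| "binop_value w Mul x y = x * y"
| "binop_value w Div x y = x div y"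
| "binop_value w Mod x y = x mod y"
| "binop_value w And x y = Bit_Operations.and x y"
| "binop_value w Or x y = Bit_Operations.or x y"
| "binop_value w Xor x y = Bit_Operations.xor x y"
| "binop_value w Shl x y = push_bit y x"
| "binop_value w Shr x y = drop_bit y x"

text \<open>\<open>None\<close> is a fault, in particular any access outside the allotted working memory.\<close>

definition fetch :: "'a list \<Rightarrow> nat \<Rightarrow> 'a option" where
  "fetch xs i = (if i < length xs then Some (xs ! i) else None)"

fun address :: "nat list \<Rightarrow> loc \<Rightarrow> nat option" where
  "address M (Cell a) = Some a"
| "address M (Deref a) = fetch M a"

fun operand_value :: "nat \<Rightarrow> nat list \<Rightarrow> operand \<Rightarrow> nat option" where
  "operand_value w M (Const k) = Some (k mod 2 ^ w)"
| "operand_value w M (At l) = do {a \<leftarrow> address M l; fetch M a}"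

definition store :: "nat \<Rightarrow> nat list \<Rightarrow> loc \<Rightarrow> nat \<Rightarrow> nat list option" where
  "store w M l x =
     do {a \<leftarrow> address M l; if a < length M then Some (M[a := x mod 2 ^ w]) else None}"

text \<open>A configuration consists of the program counter, the working memory and the output written
  so far. Each adjacency list is followed by the number of vertices as an end marker.\<close>

type_synonym config = "nat \<times> nat list \<times> nat list"

fun exec :: "nat \<Rightarrow> input \<Rightarrow> instr \<Rightarrow> config \<Rightarrow> config option" where
  "exec w I (Compute d f x y) (pc, M, out) =
     do {a \<leftarrow> operand_value w M x; b \<leftarrow> operand_value w M y;
         M' \<leftarrow> store w M d (binop_value w f a b); Some (Suc pc, M', out)}"
| "exec w I (Num_Vertices d) (pc, M, out) =
     do {M' \<leftarrow> store w M d (length (adj_lists I)); Some (Suc pc, M', out)}"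
| "exec w I (Neighbour d x y) (pc, M, out) =
     do {v \<leftarrow> operand_value w M x; i \<leftarrow> operand_value w M y;
         us \<leftarrow> fetch (adj_lists I) v; u \<leftarrow> fetch (us @ [length (adj_lists I)]) i;
         M' \<leftarrow> store w M d u; Some (Suc pc, M', out)}"
| "exec w I (Cross d x y) (pc, M, out) =
     do {v \<leftarrow> operand_value w M x; i \<leftarrow> operand_value w M y;
         js \<leftarrow> fetch (cross_ptrs I) v; j \<leftarrow> fetch js i;
         M' \<leftarrow> store w M d j; Some (Suc pc, M', out)}"
| "exec w I (Output x) (pc, M, out) =
     do {a \<leftarrow> operand_value w M x; Some (Suc pc, M, out @ [a])}"
| "exec w I (Branch_Less x y l) (pc, M, out) =
     do {a \<leftarrow> operand_value w M x; b \<leftarrow> operand_value w M y;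
         Some (if a < b then l else Suc pc, M, out)}"
| "exec w I (Branch_Eq x y l) (pc, M, out) =
     do {a \<leftarrow> operand_value w M x; b \<leftarrow> operand_value w M y;
         Some (if a = b then l else Suc pc, M, out)}"
| "exec w I Halt s = None"

definition step :: "nat \<Rightarrow> input \<Rightarrow> instr list \<Rightarrow> config \<Rightarrow> config option" where
  "step w I P s = do {c \<leftarrow> fetch P (fst s); exec w I c s}"

text \<open>\<open>run w b I P s t out\<close>: with words of \<open>w\<close> bits, the program \<open>P\<close> started in \<open>s\<close> reaches
  \<open>Halt\<close> after \<open>t\<close> steps with output \<open>out\<close>, and at all times every memory cell fits in \<open>b\<close> bits.\<close>

inductive run :: "nat \<Rightarrow> nat \<Rightarrow> input \<Rightarrow> instr list \<Rightarrow> config \<Rightarrow> nat \<Rightarrow> nat list \<Rightarrow> bool"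
  for w b :: nat and I :: input and P :: "instr list" where
  halt: "\<forall>x\<in>set M. x < 2 ^ b \<Longrightarrow> fetch P pc = Some Halt \<Longrightarrow> run w b I P (pc, M, out) 0 out"
| continue: "\<forall>x\<in>set M. x < 2 ^ b \<Longrightarrow> step w I P (pc, M, out) = Some s \<Longrightarrow>
    run w b I P s t out' \<Longrightarrow> run w b I P (pc, M, out) (Suc t) out'"

text \<open>A working memory of \<open>c\<close> cells, each \<open>b\<close> bits wide, is \<open>c * b\<close> bits of working space. The width
  \<open>b\<close> need not be the word length \<open>w\<close>, since \<open>w\<close> is only bounded from below: when \<open>w\<close> is huge, even
  a single full word would exceed \<open>o(m + n)\<close> bits.\<close>

definition computes_within ::
  "instr list \<Rightarrow> nat \<Rightarrow> input \<Rightarrow> nat list \<Rightarrow> real \<Rightarrow> real \<Rightarrow> bool" where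
  "computes_within P w I out time space \<longleftrightarrow>
     (\<exists>c b t. run w b I P (0, replicate c 0, []) t out \<and> real t \<le> time \<and> real (c * b) \<le> space)"

end

theory Submission
  imports Defs "HOL-Real_Asymp.Real_Asymp"
begin

text \<open>One bit per vertex records whether it has been visited. The current path is a stack: for every
  vertex except the root it holds the position \<open>i\<close> of its parent in its adjacency list, in unary, as
  a one followed by \<open>i\<close> zeros. The vertices of the path are distinct and \<open>i\<close> is smaller than the
  degree, so the stack never exceeds \<open>2 * m\<close> bits, and decoding an entry costs no more than scanning
  the list. Popping \<open>i\<close> yields the parent, and the cross pointer yields the position from which the
  scan of the parent's list resumes, so nothing else is stored.

  The \<open>n + 2 * m\<close> bits are packed \<open>L\<close> to a cell, where \<open>n < 2 ^ L \<le> 2 * n\<close>. Since \<open>2 * m \<le> n * n\<close>,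
  addresses and bit positions fit in cells of \<open>2 * L + 4\<close> bits; half of each packed cell is thus
  wasted, which gives \<open>4 * m + 2 * n\<close> bits up to lower-order terms.\<close>

section \<open>Bit vectors packed into memory cells\<close>

definition packs :: "nat \<Rightarrow> nat list \<Rightarrow> nat set \<Rightarrow> bool" where
  "packs L A X \<longleftrightarrow> (\<forall>x\<in>set A. x < 2 ^ L) \<and>
     (\<forall>q. q div L < length A \<longrightarrow> (bit (A ! (q div L)) (q mod L) \<longleftrightarrow> q \<in> X))"

lemma packs_zero: "packs L (replicate c 0) {}"
  by (auto simp: packs_def)

lemma packs_less: "packs L A X \<Longrightarrow> x \<in> set A \<Longrightarrow> x < 2 ^ L"
  by (simp add: packs_def)

lemma and_exp_nat: "Bit_Operations.and x (2 ^ k) = (if bit x k then 2 ^ k else (0 :: nat))"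
  by (rule bit_eqI) (auto simp: bit_and_iff bit_exp_iff)

lemma packs_test:
  assumes "packs L A X" "q div L < length A"
  shows "Bit_Operations.and (A ! (q div L)) (2 ^ (q mod L)) = (if q \<in> X then 2 ^ (q mod L) else 0)"
  using assms by (simp add: packs_def and_exp_nat)

lemma xor_exp_less:
  assumes "x < 2 ^ L" "k < L"
  shows "Bit_Operations.xor x (2 ^ k) < (2 ^ L :: nat)"
proof -
  have "take_bit L (Bit_Operations.xor x (2 ^ k)) = Bit_Operations.xor x (2 ^ k)"
    using assms by (simp add: take_bit_xor take_bit_nat_eq_self)
  then show ?thesis by (metis take_bit_nat_less_exp)
qed

text \<open>Marking a vertex, pushing a one and popping a one all use the same \<open>Xor\<close>
  instruction, so both directions are treated at once.\<close>

lemma packs_flip: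
  assumes pk: "packs L A X" and q: "q div L < length A" and L: "0 < L"
  shows "packs L (A[q div L := Bit_Operations.xor (A ! (q div L)) (2 ^ (q mod L))])
    (if q \<in> X then X - {q} else insert q X)"
  unfolding packs_def
proof (intro conjI ballI allI impI)
  fix x assume "x \<in> set (A[q div L := Bit_Operations.xor (A ! (q div L)) (2 ^ (q mod L))])"
  then have "x \<in> set A \<or> x = Bit_Operations.xor (A ! (q div L)) (2 ^ (q mod L))"
    using set_update_subset_insert by fastforce
  then show "x < 2 ^ L"
    using packs_less[OF pk] xor_exp_less q L by auto
next
  fix r assume r: "r div L < length (A[q div L := Bit_Operations.xor (A ! (q div L)) (2 ^ (q mod L))])"
  have "r = q \<longleftrightarrow> r div L = q div L \<and> r mod L = q mod L"
    by (metis div_mult_mod_eq)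
  then show "bit (A[q div L := Bit_Operations.xor (A ! (q div L)) (2 ^ (q mod L))] ! (r div L)) (r mod L)
     \<longleftrightarrow> r \<in> (if q \<in> X then X - {q} else insert q X)"
    using pk r q by (auto simp: packs_def nth_list_update bit_xor_iff bit_exp_iff)
qed

lemma packs_insert:
  "packs L A X \<Longrightarrow> q div L < length A \<Longrightarrow> 0 < L \<Longrightarrow> q \<notin> X \<Longrightarrow>
   packs L (A[q div L := Bit_Operations.xor (A ! (q div L)) (2 ^ (q mod L))]) (insert q X)"
  using packs_flip[of L A X q] by simp

lemma packs_remove:
  "packs L A X \<Longrightarrow> q div L < length A \<Longrightarrow> 0 < L \<Longrightarrow> q \<in> X \<Longrightarrow>
   packs L (A[q div L := Bit_Operations.xor (A ! (q div L)) (2 ^ (q mod L))]) (X - {q})"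
  using packs_flip[of L A X q] by simp

section \<open>The program\<close>

text \<open>Memory cells used as registers: 0 current vertex, 1 position in its list, 2 stack pointer (a bit position),
  3 bits per cell, 4 cell address, 5 bit mask, 6 neighbour, 7 number of vertices, 8 scratch.
  The bit vector starts at cell 9: first the visited bits, then from bit \<open>n\<close> on the stack.
  Instructions 3 to 6 compute the number of bits per cell, 10 is the head of the main loop, 20 moves
  to a new vertex, and 34 leaves the current one.\<close>

abbreviation "reg k \<equiv> At (Cell k)"
abbreviation "goto l \<equiv> Branch_Eq (Const 0) (Const 0) l"

definition dfs_prog :: "instr list" where
  "dfs_prog =
   [Num_Vertices (Cell 7),
    Compute (Cell 2) Add (reg 7) (Const 0),
    Compute (Cell 5) Add (Const 1) (Const 0),
    Branch_Less (reg 7) (reg 5) 7,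
    Compute (Cell 5) Add (reg 5) (reg 5),
    Compute (Cell 3) Add (reg 3) (Const 1),
    goto 3,
    Compute (Cell 9) Add (Const 1) (Const 0),
    Output (Const 0),
    Output (Const 0),
    Neighbour (Cell 6) (reg 0) (reg 1),
    Branch_Eq (reg 6) (reg 7) 34,
    Compute (Cell 4) Div (reg 6) (reg 3),
    Compute (Cell 4) Add (reg 4) (Const 9),
    Compute (Cell 5) Mod (reg 6) (reg 3),
    Compute (Cell 5) Shl (Const 1) (reg 5),
    Compute (Cell 8) And (At (Deref 4)) (reg 5),
    Branch_Eq (reg 8) (Const 0) 20,
    Compute (Cell 1) Add (reg 1) (Const 1),
    goto 10,
    Compute (Deref 4) Xor (At (Deref 4)) (reg 5),
    Output (Const 0),
    Output (reg 6),
    Cross (Cell 8) (reg 0) (reg 1),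
    Compute (Cell 4) Div (reg 2) (reg 3),
    Compute (Cell 4) Add (reg 4) (Const 9),
    Compute (Cell 5) Mod (reg 2) (reg 3),
    Compute (Cell 5) Shl (Const 1) (reg 5),
    Compute (Deref 4) Xor (At (Deref 4)) (reg 5),
    Compute (Cell 2) Add (reg 2) (reg 8),
    Compute (Cell 2) Add (reg 2) (Const 1),
    Compute (Cell 0) Add (reg 6) (Const 0),
    Compute (Cell 1) Add (Const 0) (Const 0),
    goto 10,
    Output (Const 1),
    Output (reg 0),
    Branch_Eq (reg 2) (reg 7) 52,
    Compute (Cell 8) Add (Const 0) (Const 0),
    Compute (Cell 2) Sub (reg 2) (Const 1),
    Compute (Cell 4) Div (reg 2) (reg 3),
    Compute (Cell 4) Add (reg 4) (Const 9),
    Compute (Cell 5) Mod (reg 2) (reg 3),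
    Compute (Cell 5) Shl (Const 1) (reg 5),
    Compute (Cell 6) And (At (Deref 4)) (reg 5),
    Branch_Eq (reg 6) (reg 5) 47,
    Compute (Cell 8) Add (reg 8) (Const 1),
    goto 38,
    Compute (Deref 4) Xor (At (Deref 4)) (reg 5),
    Cross (Cell 1) (reg 0) (reg 8),
    Neighbour (Cell 0) (reg 0) (reg 8),
    Compute (Cell 1) Add (reg 1) (Const 1),
    goto 10,
    Halt]"

text \<open>Separate arguments for the nine registers let the simplifier evaluate reads and writes
  symbolically, without list indices.\<close>

definition mem ::
  "nat \<Rightarrow> nat \<Rightarrow> nat \<Rightarrow> nat \<Rightarrow> nat \<Rightarrow> nat \<Rightarrow> nat \<Rightarrow> nat \<Rightarrow> nat \<Rightarrow> nat list \<Rightarrow> nat list" where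
  "mem u p s l a x v n i A = [u, p, s, l, a, x, v, n, i] @ A"

lemma operand_mem [simp]:
  "operand_value w (mem u p s l a x v n i A) (reg 0) = Some u"
  "operand_value w (mem u p s l a x v n i A) (reg (Suc 0)) = Some p"
  "operand_value w (mem u p s l a x v n i A) (reg 2) = Some s"
  "operand_value w (mem u p s l a x v n i A) (reg 3) = Some l"
  "operand_value w (mem u p s l a x v n i A) (reg 4) = Some a"
  "operand_value w (mem u p s l a x v n i A) (reg 5) = Some x"
  "operand_value w (mem u p s l a x v n i A) (reg 6) = Some v"
  "operand_value w (mem u p s l a x v n i A) (reg 7) = Some n"
  "operand_value w (mem u p s l a x v n i A) (reg 8) = Some i"
  by (simp_all add: mem_def fetch_def)

lemma operand_mem_deref [simp]:
  "q < length A \<Longrightarrow> operand_value w (mem u p s l (q + 9) x v n i A) (At (Deref 4)) = Some (A ! q)"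
  by (simp add: mem_def fetch_def)

lemma store_mem [simp]:
  "store w (mem u p s l a x v n i A) (Cell 0) y = Some (mem (y mod 2 ^ w) p s l a x v n i A)"
  "store w (mem u p s l a x v n i A) (Cell (Suc 0)) y = Some (mem u (y mod 2 ^ w) s l a x v n i A)"
  "store w (mem u p s l a x v n i A) (Cell 2) y = Some (mem u p (y mod 2 ^ w) l a x v n i A)"
  "store w (mem u p s l a x v n i A) (Cell 3) y = Some (mem u p s (y mod 2 ^ w) a x v n i A)"
  "store w (mem u p s l a x v n i A) (Cell 4) y = Some (mem u p s l (y mod 2 ^ w) x v n i A)"
  "store w (mem u p s l a x v n i A) (Cell 5) y = Some (mem u p s l a (y mod 2 ^ w) v n i A)"
  "store w (mem u p s l a x v n i A) (Cell 6) y = Some (mem u p s l a x (y mod 2 ^ w) n i A)"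
  "store w (mem u p s l a x v n i A) (Cell 7) y = Some (mem u p s l a x v (y mod 2 ^ w) i A)"
  "store w (mem u p s l a x v n i A) (Cell 8) y = Some (mem u p s l a x v n (y mod 2 ^ w) A)"
  by (simp_all add: mem_def store_def eval_nat_numeral)

lemma store_mem_vector [simp]:
  "A \<noteq> [] \<Longrightarrow> store w (mem u p s l a x v n i A) (Cell 9) y =
     Some (mem u p s l a x v n i (A[0 := y mod 2 ^ w]))"
  by (simp add: mem_def store_def eval_nat_numeral)

lemma store_mem_deref [simp]:
  "q < length A \<Longrightarrow> store w (mem u p s l (q + 9) x v n i A) (Deref 4) y =
     Some (mem u p s l (q + 9) x v n i (A[q := y mod 2 ^ w]))"
  by (simp add: mem_def store_def fetch_def eval_nat_numeral)

declare operand_value.simps(2) [simp del]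

lemma set_mem: "(\<forall>y\<in>set (mem u p s l a x v n i A). y < B) \<longleftrightarrow>
    u < B \<and> p < B \<and> s < B \<and> l < B \<and> a < B \<and> x < B \<and> v < B \<and> n < B \<and> i < B \<and> (\<forall>y\<in>set A. y < B)"
  by (auto simp: mem_def)

section \<open>Symbolic execution\<close>

text \<open>The optional start configuration accepts the result of \<open>step\<close> directly, and
  since \<open>T\<close> is only an upper bound, budgets can be weakened freely.\<close>

definition halts :: "nat \<Rightarrow> nat \<Rightarrow> input \<Rightarrow> config option \<Rightarrow> nat \<Rightarrow> nat list \<Rightarrow> bool" where
  "halts w b I so T out \<longleftrightarrow> (\<exists>s t. so = Some s \<and> t \<le> T \<and> run w b I dfs_prog s t out)"

lemma halts_step:
  assumes "\<forall>y\<in>set M. y < 2 ^ b" "0 < T" "halts w b I (step w I dfs_prog (pc, M, out)) (T - 1) out'"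
  shows "halts w b I (Some (pc, M, out)) T out'"
proof -
  obtain s t where s: "step w I dfs_prog (pc, M, out) = Some s" and t: "t \<le> T - 1"
    and r: "run w b I dfs_prog s t out'"
    using assms(3) by (auto simp: halts_def)
  have "run w b I dfs_prog (pc, M, out) (Suc t) out'"
    by (rule run.continue[OF assms(1) s r])
  moreover have "Suc t \<le> T" using t assms(2) by simp
  ultimately show ?thesis by (auto simp: halts_def)
qed

lemma halts_halt: "\<forall>y\<in>set M. y < 2 ^ b \<Longrightarrow> halts w b I (Some (52, M, out)) T out"
  unfolding halts_def
  by (intro exI[of _ "(52, M, out)"] exI[of _ 0]) (auto intro!: run.halt simp: fetch_def dfs_prog_def)

lemma halts_mono: "halts w b I s T out \<Longrightarrow> T \<le> T' \<Longrightarrow> halts w b I s T' out"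
  unfolding halts_def using le_trans by blast

lemma step_dfs_prog: "i < 53 \<Longrightarrow> step w I dfs_prog (i, s) = exec w I (dfs_prog ! i) (i, s)"
  by (simp add: step_def fetch_def dfs_prog_def)

text \<open>Unfolds the program only where an instruction is looked up; its occurrence in the next
  goal stays folded.\<close>

lemmas nth_dfs_prog = arg_cong[where f = "\<lambda>xs. xs ! i" for i, OF dfs_prog_def]

section \<open>Degrees and cross pointers of the input graph\<close>

locale graph_input =
  fixes n m :: nat and E :: "nat set set" and I :: input
  assumes rep: "represents I n E"
    and simple: "simple_graph n E"
    and n_pos: "0 < n"
    and m_def: "m = card E"
begin

abbreviation "adj v \<equiv> adj_lists I ! v"
abbreviation "deg v \<equiv> length (adj v)"
abbreviation "cross v \<equiv> cross_ptrs I ! v"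

lemma length_adj [simp]: "length (adj_lists I) = n" "length (cross_ptrs I) = n"
  using rep by (auto simp: represents_def)

lemma adj_props:
  assumes "v < n"
  shows "distinct (adj v)" "set (adj v) = {u. {v, u} \<in> E}" "length (cross v) = deg v"
  using rep assms by (auto simp: represents_def)

lemma adj_less: "v < n \<Longrightarrow> u \<in> set (adj v) \<Longrightarrow> u < n \<and> u \<noteq> v"
  using simple adj_props(2)[of v] by (auto simp: simple_graph_def doubleton_eq_iff dest!: subsetD)

lemma cross_props:
  assumes "v < n" "i < deg v"
  shows "cross v ! i < deg (adj v ! i)" "adj (adj v ! i) ! (cross v ! i) = v"
  using rep assms by (auto simp: represents_def Let_def)

text \<open>Both positions hold the same neighbour, and a list has no repetitions. This is why a pop
  recovers the position at which the scan of the parent stopped.\<close>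

lemma cross_cross:
  assumes "v < n" "i < deg v"
  shows "cross (adj v ! i) ! (cross v ! i) = i"
proof -
  have u: "adj v ! i < n" using adj_less assms by auto
  note 1 = cross_props[OF assms]
  note 2 = cross_props[OF u 1(1)]
  show ?thesis
    using 2 1 assms adj_props(1)[OF assms(1)] by (simp add: nth_eq_iff_index_eq)
qed

lemma deg_less: "v < n \<Longrightarrow> deg v < n"
proof -
  assume v: "v < n"
  have "deg v = card (set (adj v))" using adj_props(1)[OF v] by (simp add: distinct_card)
  also have "\<dots> \<le> card ({..<n} - {v})" using adj_less[OF v] by (intro card_mono) auto
  also have "\<dots> < n" using v by simp
  finally show ?thesis .
qed

text \<open>Double counting: the list of a vertex is in bijection with its incident edges, and every
  edge has two ends.\<close>

lemma handshake: "(\<Sum>v<n. deg v) = 2 * m"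
proof -
  have fin: "finite E"
    using simple by (auto simp: simple_graph_def intro!: finite_subset[of E "Pow {..<n}"])
  have "deg v = card {e \<in> E. v \<in> e}" if v: "v < n" for v
  proof -
    have "{e \<in> E. v \<in> e} = (\<lambda>u. {v, u}) ` set (adj v)"
    proof (intro equalityI subsetI)
      fix e assume e: "e \<in> {e \<in> E. v \<in> e}"
      then obtain x y where xy: "e = {x, y}" using simple by (auto simp: simple_graph_def)
      have "\<exists>u. e = {v, u}" using e unfolding xy by auto
      then show "e \<in> (\<lambda>u. {v, u}) ` set (adj v)" using e adj_props(2)[OF v] by auto
    qed (use adj_props(2)[OF v] in auto)
    moreover have "inj_on (\<lambda>u. {v, u}) (set (adj v))"
      by (auto simp: inj_on_def doubleton_eq_iff)
    ultimately show ?thesis using adj_props(1)[OF v] by (simp add: card_image distinct_card)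
  qed
  then have "(\<Sum>v<n. deg v) = (\<Sum>v<n. card {e \<in> E. v \<in> e})" by simp
  also have "\<dots> = (\<Sum>e\<in>E. 2)"
  proof (rule sum_multicount_gen)
    show "\<forall>e\<in>E. card {v \<in> {..<n}. v \<in> e} = 2"
    proof
      fix e assume "e \<in> E"
      then obtain x y where "e = {x, y}" "x < n" "y < n" "x \<noteq> y"
        using simple by (auto simp: simple_graph_def)
      moreover then have "{v \<in> {..<n}. v \<in> e} = {x, y}" by auto
      ultimately show "card {v \<in> {..<n}. v \<in> e} = 2" by simp
    qed
  qed (use fin in auto)
  finally show ?thesis using m_def by simp
qed

lemma edges_le: "2 * m \<le> n * n"
proof -
  have "(\<Sum>v<n. deg v) \<le> (\<Sum>v<n. n)" using deg_less by (intro sum_mono) (auto intro: less_imp_le)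
  then show ?thesis using handshake by simp
qed

end

text \<open>\<open>N\<close> exceeds every value kept in a cell: bit positions up to
  \<open>n + 2 * m\<close>, addresses shifted by 9, masks and packed cells bounded by
  \<open>2 ^ L\<close>. Values of this size survive the reduction modulo \<open>2 ^ w\<close> and
  fit in \<open>b\<close> bits.\<close>

locale dfs_machine = graph_input +
  fixes w b L c N :: nat
  assumes L_pos: "0 < L"
    and n_less: "n < 2 ^ L" and exp_le: "2 ^ L \<le> 2 * n"
    and N_eq: "N = 2 * n + 2 * m + 10"
    and N_w: "N \<le> 2 ^ w" and N_b: "N \<le> 2 ^ b"
    and c_eq: "c = (n + 2 * m) div L + 1"
begin

lemma mod_w [simp]: "x < N \<Longrightarrow> x mod 2 ^ w = x"
  using N_w by simp

lemma less_b: "x < N \<Longrightarrow> x < 2 ^ b"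
  using N_b by simp

lemma small [simp]: "0 < N" "Suc 0 < N" "9 < N"
  using N_eq by auto

lemma w_pos [simp]: "0 < w"
  using N_w N_eq by (cases w) auto

lemma position_bounds:
  assumes "q \<le> n + 2 * m"
  shows "q div L < c" "q < N" "q div L + 9 < N" "q div L < N" "q mod L < N"
    "2 ^ (q mod L) < N"
proof -
  have d: "q div L \<le> q" by simp
  show "q div L < c"
    using assms c_eq by (simp add: div_le_mono less_Suc_eq_le)
  show "q < N" "q div L + 9 < N" "q div L < N" "q mod L < N"
    using assms N_eq d mod_less_eq_dividend[of q L] by linarith+
  have "(2::nat) ^ (q mod L) < 2 ^ L" using L_pos by simp
  then show "2 ^ (q mod L) < N" using exp_le N_eq by linarith
qed

lemma packs_N: "packs L A X \<Longrightarrow> x \<in> set A \<Longrightarrow> x < N"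
  using packs_less[of L A X x] exp_le N_eq by linarith

text \<open>Registers 4, 5, 6 and 8 hold no information at the head of the main loop.\<close>

definition runs :: "nat \<Rightarrow> nat \<Rightarrow> nat \<Rightarrow> nat \<Rightarrow> nat set \<Rightarrow> nat list \<Rightarrow> nat \<Rightarrow> nat list \<Rightarrow> bool" where
  "runs pc u p s X out T out' \<longleftrightarrow>
     (\<forall>a x v i A. a < N \<longrightarrow> x < N \<longrightarrow> v < N \<longrightarrow> i < N \<longrightarrow> length A = c \<longrightarrow> packs L A X \<longrightarrow>
        halts w b I (Some (pc, mem u p s L a x v n i A, out)) T out')"

lemma runsD:
  "runs pc u p s X out T out' \<Longrightarrow> a < N \<Longrightarrow> x < N \<Longrightarrow> v < N \<Longrightarrow> i < N \<Longrightarrow> length A = c \<Longrightarrow> packs L A X \<Longrightarrow>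
    halts w b I (Some (pc, mem u p s L a x v n i A, out)) T out'"
  by (simp add: runs_def)

lemma runs_mono:
  "runs pc u p s X out T out' \<Longrightarrow> T \<le> T' \<Longrightarrow> runs pc u p s X out T' out'"
  unfolding runs_def using halts_mono by blast

lemma L_less: "L < N"
proof -
  have "L < 2 ^ L" by simp
  then show ?thesis using exp_le N_eq by linarith
qed

lemma n_less_N: "n < N"
  using N_eq by simp

text \<open>One application executes one instruction. \<open>X\<close> serves to bound the packed
  cells; it has to be supplied, and changes whenever a bit has been flipped.\<close>

lemma mem_step:
  assumes "u < N \<and> p < N \<and> s < N \<and> l < N \<and> a < N \<and> x < N \<and> v < N \<and> k < N \<and> i < N \<and>
      0 < T \<and> packs L A X"
    and "halts w b I (step w I dfs_prog (pc, mem u p s l a x v k i A, out)) (T - 1) out'"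
  shows "halts w b I (Some (pc, mem u p s l a x v k i A, out)) T out'"
proof (rule halts_step)
  show "\<forall>y\<in>set (mem u p s l a x v k i A). y < 2 ^ b"
    using assms(1) packs_N by (auto simp: set_mem intro!: less_b)
qed (use assms in auto)

lemmas exec_simps = step_dfs_prog nth_dfs_prog L_less n_less_N

lemma flip_less:
  assumes "packs L A X" "q div L < length A"
  shows "Bit_Operations.xor (A ! (q div L)) (2 ^ (q mod L)) < N"
proof -
  have "Bit_Operations.xor (A ! (q div L)) (2 ^ (q mod L)) < 2 ^ L"
    using assms L_pos by (intro xor_exp_less) (auto simp: packs_def)
  then show ?thesis using exp_le N_eq by linarith
qed

section \<open>Timed rules for the phases of the program\<close>

lemma runs_skip:
  assumes "u < n" "p < deg u" "adj u ! p \<in> X" "s < N"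
    and next_: "runs 10 u (Suc p) s X out T out'"
  shows "runs 10 u p s X out (T + 10) out'"
  unfolding runs_def
proof (intro allI impI)
  fix a x v i A
  assume A: "a < N" "x < N" "v < N" "i < N" "length A = c" "packs L A X"
  define y where "y = adj u ! p"
  have y: "y < n" using adj_less[OF assms(1), of y] assms(2) y_def by simp
  have yb: "y \<le> n + 2 * m" using y by simp
  note pb = position_bounds[OF yb]
  have *: "u < N" "p < N" "Suc p < N" "s < N"
    using assms deg_less[of u] y N_eq pb by linarith+
  have f: "fetch (adj u @ [n]) p = Some y" "fetch (adj_lists I) u = Some (adj u)"
    using assms by (auto simp: fetch_def nth_append y_def)
  have t: "Bit_Operations.and (A ! (y div L)) (2 ^ (y mod L)) = 2 ^ (y mod L)"
    using packs_test[OF A(6), of y] A(5) pb assms y_def by simp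
  note facts = A * pb f t less_imp_neq[OF y]
  show "halts w b I (Some (10, mem u p s L a x v n i A, out)) (T + 10) out'"
    \<comment> \<open>The repetition stops by itself: once the budget is down to \<open>T\<close>,
      \<open>0 < T\<close> cannot be shown. Instructions 10 to 19 have then been executed.\<close>
    apply ((rule mem_step[where X = X], (simp add: facts exec_simps; fail), simp add: exec_simps facts)+)[1]
    apply (rule runsD[OF next_], simp_all add: facts)
    done
qed

text \<open>Setting the visited bit gives \<open>A1\<close> and writing the one gives
  \<open>A2\<close>, hence three stretches of execution. The zeros of the new entry are never
  written: in the traversal all bits from the stack pointer on are zero, so moving the pointer
  suffices.\<close>

lemma runs_tree:
  assumes "u < n" "p < deg u" "adj u ! p \<notin> X" "n \<le> s" "s \<notin> X"
    and s: "s + cross u ! p + 1 \<le> n + 2 * m"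
    and next_: "runs 10 (adj u ! p) 0 (s + cross u ! p + 1) (insert s (insert (adj u ! p) X))
      (out @ [0, adj u ! p]) T out'"
  shows "runs 10 u p s X out (T + 22) out'"
  unfolding runs_def
proof (intro allI impI)
  fix a x v i A
  assume A: "a < N" "x < N" "v < N" "i < N" "length A = c" "packs L A X"
  define y where "y = adj u ! p"
  define j where "j = cross u ! p"
  have y: "y < n" using adj_less[OF assms(1), of y] assms(2) y_def by simp
  have yb: "y \<le> n + 2 * m" using y by simp
  have sb: "s \<le> n + 2 * m" using s by simp
  note pb = position_bounds[OF yb]
  note ps = position_bounds[OF sb]
  have *: "u < N" "p < N" "Suc p < N" "s < N" "s + j < N" "Suc (s + j) < N" "j < N"
    using assms deg_less[of u] y N_eq pb unfolding j_def by linarith+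
  have f: "fetch (adj u @ [n]) p = Some y" "fetch (adj_lists I) u = Some (adj u)"
    "fetch (cross_ptrs I) u = Some (cross u)" "fetch (cross u) p = Some j"
    using assms adj_props(3)[OF assms(1)] by (auto simp: fetch_def nth_append y_def j_def)
  have t: "Bit_Operations.and (A ! (y div L)) (2 ^ (y mod L)) = 0"
    using packs_test[OF A(6), of y] A(5) pb assms y_def by simp
  define A1 where "A1 = A[y div L := Bit_Operations.xor (A ! (y div L)) (2 ^ (y mod L))]"
  define A2 where "A2 = A1[s div L := Bit_Operations.xor (A1 ! (s div L)) (2 ^ (s mod L))]"
  have A1: "packs L A1 (insert y X)" "length A1 = c"
    using packs_insert[OF A(6) _ L_pos, of y] A pb assms by (auto simp: A1_def y_def)
  have "s \<noteq> y" using y assms(4) by simp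
  then have A2: "packs L A2 (insert s (insert y X))" "length A2 = c"
    using packs_insert[OF A1(1) _ L_pos, of s] A1(2) ps assms by (auto simp: A2_def)
  have fl: "Bit_Operations.xor (A ! (y div L)) (2 ^ (y mod L)) < N"
    "Bit_Operations.xor (A1 ! (s div L)) (2 ^ (s mod L)) < N"
    using flip_less[OF A(6)] flip_less[OF A1(1)] A(5) A1(2) pb ps by auto
  note facts = A * pb ps f t A1 A2 fl A1_def[symmetric] A2_def[symmetric] less_imp_neq[OF y]
  have n: "runs 10 y 0 (Suc (s + j)) (insert s (insert y X)) (out @ [0, y]) T out'"
    using next_ by (simp add: y_def j_def)
  show "halts w b I (Some (10, mem u p s L a x v n i A, out)) (T + 22) out'"
    apply ((rule mem_step[where X = X], (simp add: facts exec_simps; fail), simp add: exec_simps facts)+)[1]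
    apply ((rule mem_step[where X = "insert y X"], (simp add: facts exec_simps; fail), simp add: exec_simps facts)+)[1]
    apply ((rule mem_step[where X = "insert s (insert y X)"], (simp add: facts exec_simps; fail), simp add: exec_simps facts)+)[1]
    apply (rule runsD[OF n], simp_all add: facts)
    done
qed

text \<open>A stack pointer equal to \<open>n\<close> means an empty stack, so the vertex being left
  is the root.\<close>

lemma runs_finish:
  assumes "u < n"
  shows "runs 10 u (deg u) n X out 5 (out @ [1, u])"
  unfolding runs_def
proof (intro allI impI)
  fix a x v i A
  assume A: "a < N" "x < N" "v < N" "i < N" "length A = c" "packs L A X"
  have *: "u < N" "deg u < N"
    using assms deg_less[of u] N_eq by linarith+
  have f: "fetch (adj u @ [n]) (deg u) = Some n" "fetch (adj_lists I) u = Some (adj u)"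
    using assms by (auto simp: fetch_def nth_append)
  note facts = A * f
  show "halts w b I (Some (10, mem u (deg u) n L a x v n i A, out)) 5 (out @ [1, u])"
    apply ((rule mem_step[where X = X], (simp add: facts exec_simps; fail), simp add: exec_simps facts)+)[1]
    apply (rule halts_halt)
    using packs_N[OF A(6)] by (auto simp: set_mem facts exec_simps intro!: less_b)
qed

text \<open>Decodes the top entry from its upper end: nine steps for each zero, counted in cell 8,
  and seven for the one that ends the entry.\<close>

lemma pop_loop:
  assumes "s + d < n + 2 * m" "s \<in> X" "\<forall>q. s < q \<and> q \<le> s + d \<longrightarrow> q \<notin> X"
    and "length A = c" "packs L A X" "u < N" "p < N" "a < N" "x < N" "v < N" "i + d < N"
    and next_: "halts w b I (Some (47, mem u p s L (s div L + 9) (2 ^ (s mod L)) (2 ^ (s mod L))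
      n (i + d) A, out)) T out'"
  shows "halts w b I (Some (38, mem u p (Suc (s + d)) L a x v n i A, out)) (T + 9 * d + 7) out'"
  using assms
proof (induction d arbitrary: i a x v)
  case 0
  have sb: "s \<le> n + 2 * m" and *: "Suc s < N" using 0(1) N_eq by auto
  note ps = position_bounds[OF sb]
  have t: "Bit_Operations.and (A ! (s div L)) (2 ^ (s mod L)) = 2 ^ (s mod L)"
    using packs_test[OF 0(5), of s] 0 ps by simp
  have n: "halts w b I (Some (47, mem u p s L (s div L + 9) (2 ^ (s mod L)) (2 ^ (s mod L))
      n i A, out)) T out'"
    using 0(12) by simp
  note facts = 0(4-11) * ps t
  have "halts w b I (Some (38, mem u p (Suc s) L a x v n i A, out)) (T + 7) out'"
    apply ((rule mem_step[where X = X], (use facts in \<open>simp add: exec_simps\<close>; fail), use facts in \<open>simp add: exec_simps\<close>)+)[1]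
    apply (rule n)
    done
  then show ?case by simp
next
  case (Suc d)
  define q where "q = Suc (s + d)"
  have qb: "q \<le> n + 2 * m" and *: "Suc q < N" using Suc.prems(1) N_eq q_def by auto
  note pq = position_bounds[OF qb]
  have "q \<notin> X" using Suc.prems(3) q_def by simp
  then have t: "Bit_Operations.and (A ! (q div L)) (2 ^ (q mod L)) = 0"
    using packs_test[OF Suc.prems(5), of q] Suc.prems pq by simp
  have i: "i < N" "Suc i < N" using Suc.prems by auto
  note facts = Suc.prems(4-10) * pq t i
  define T1 where "T1 = T + 9 * d + 7"
  have n: "halts w b I (Some (38, mem u p q L (q div L + 9) (2 ^ (q mod L)) 0 n (Suc i) A, out))
      T1 out'"
    unfolding q_def T1_def
  proof (rule Suc.IH)
    show "\<forall>r. s < r \<and> r \<le> s + d \<longrightarrow> r \<notin> X" using Suc.prems(3) by simp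
    show "halts w b I (Some (47, mem u p s L (s div L + 9) (2 ^ (s mod L)) (2 ^ (s mod L))
      n (Suc i + d) A, out)) T out'" using Suc.prems(12) by simp
  qed (use Suc.prems(1,2,4-7,11) pq in \<open>simp_all add: q_def\<close>)
  have "halts w b I (Some (38, mem u p (Suc q) L a x v n i A, out)) (T1 + 9) out'"
    apply ((rule mem_step[where X = X], (use facts in \<open>simp add: exec_simps\<close>; fail), use facts in \<open>simp add: exec_simps\<close>)+)[1]
    apply (rule n)
    done
  then show ?case by (simp add: q_def T1_def add_ac)
qed

text \<open>Six instructions lead to the decoding loop, which takes \<open>9 * i + 7\<close>, and
  five more flip the one and return to the parent. The cross pointer is read before cell 0 is
  overwritten by the parent.\<close>

lemma runs_retreat:
  assumes "u < n" "i < deg u" "n \<le> s" "s + i < n + 2 * m" "s \<in> X"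
    and gap: "\<forall>q. s < q \<and> q \<le> s + i \<longrightarrow> q \<notin> X"
    and next_: "runs 10 (adj u ! i) (Suc (cross u ! i)) s (X - {s}) (out @ [1, u]) T out'"
  shows "runs 10 u (deg u) (Suc (s + i)) X out (T + 9 * i + 18) out'"
  unfolding runs_def
proof (intro allI impI)
  fix a x v i' A
  assume A: "a < N" "x < N" "v < N" "i' < N" "length A = c" "packs L A X"
  define y where "y = adj u ! i"
  define j where "j = cross u ! i"
  have y: "y < n" using adj_less[OF assms(1), of y] assms(2) y_def by simp
  have "j < deg y" using cross_props[OF assms(1,2)] by (simp add: j_def y_def)
  then have *: "u < N" "deg u < N" "Suc (s + i) < N" "i < N" "j < N" "Suc j < N" "y < N"
    using assms deg_less[of u] deg_less[of y] y N_eq by linarith+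
  have sb: "s \<le> n + 2 * m" using assms by simp
  note ps = position_bounds[OF sb]
  have f: "fetch (adj u @ [n]) (deg u) = Some n" "fetch (adj_lists I) u = Some (adj u)"
    "fetch (adj u @ [n]) i = Some y" "fetch (cross_ptrs I) u = Some (cross u)" "fetch (cross u) i = Some j"
    using assms adj_props(3)[OF assms(1)] by (auto simp: fetch_def nth_append y_def j_def)
  define A1 where "A1 = A[s div L := Bit_Operations.xor (A ! (s div L)) (2 ^ (s mod L))]"
  have A1: "packs L A1 (X - {s})" "length A1 = c"
    using packs_remove[OF A(6) _ L_pos, of s] A ps assms by (auto simp: A1_def)
  have fl: "Bit_Operations.xor (A ! (s div L)) (2 ^ (s mod L)) < N"
    using flip_less[OF A(6)] A(5) ps by auto
  have ne: "Suc (s + i) \<noteq> n" using assms(3) by simp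
  note facts = A * ps f A1 fl A1_def[symmetric] ne
  have n: "runs 10 y (Suc j) s (X - {s}) (out @ [Suc 0, u]) T out'"
    using next_ by (simp add: y_def j_def)
  have 47: "halts w b I (Some (47, mem u (deg u) s L (s div L + 9) (2 ^ (s mod L)) (2 ^ (s mod L))
      n i A, out @ [Suc 0, u])) (T + 5) out'"
    apply (rule mem_step[where X = X], (simp add: facts exec_simps; fail), simp add: exec_simps facts)
    apply ((rule mem_step[where X = "X - {s}"], (simp add: facts exec_simps; fail), simp add: exec_simps facts)+)[1]
    apply (rule runsD[OF n], simp_all add: facts)
    done
  define T1 where "T1 = T + 5 + 9 * i + 7"
  have 38: "halts w b I (Some (38, mem u (deg u) (Suc (s + i)) L a x n n 0 A, out @ [Suc 0, u]))
      T1 out'"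
    unfolding T1_def using 47 assms A * by (intro pop_loop[where X = X]) (auto simp: n_less_N)
  have "halts w b I (Some (10, mem u (deg u) (Suc (s + i)) L a x v n i' A, out))
      (T1 + 6) out'"
    apply ((rule mem_step[where X = X], (simp add: facts exec_simps; fail), simp add: exec_simps facts)+)[1]
    apply (rule 38)
    done
  then show "halts w b I (Some (10, mem u (deg u) (Suc (s + i)) L a x v n i' A, out))
      (T + 9 * i + 18) out'"
    by (rule halts_mono) (simp add: T1_def)
qed

text \<open>Cell 5 holds \<open>2 ^ k\<close> while cell 3 counts \<open>k\<close>. Each doubling
  takes four steps and the exit one; the induction descends from the exit at
  \<open>L\<close>.\<close>

lemma init_loop:
  assumes "k \<le> L"
    and next_: "halts w b I (Some (7, mem 0 0 n L 0 (2 ^ L) 0 n 0 (replicate c 0), [])) T out'"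
  shows "halts w b I (Some (3, mem 0 0 n k 0 (2 ^ k) 0 n 0 (replicate c 0), []))
    (T + 4 * (L - k) + 1) out'"
  using assms(1)
proof (induction k rule: inc_induct)
  case base
  have l: "2 ^ L < N" using exp_le N_eq by linarith
  show ?case
    apply (rule mem_step[where X = "{}"], simp add: exec_simps l packs_zero, simp add: exec_simps l n_less)
    apply (rule next_)
    done
next
  case (step k)
  \<comment> \<open>Below \<open>L\<close> the loop continues:
    \<open>2 * 2 ^ k \<le> 2 ^ L \<le> 2 * n\<close> gives \<open>2 ^ k \<le> n\<close>.\<close>
  have "(2::nat) * 2 ^ k \<le> 2 ^ L"
    using step(2) power_increasing[of "Suc k" L "2::nat"] by simp
  then have k: "\<not> n < 2 ^ k" "2 ^ k < N" "2 ^ k + 2 ^ k < N" "k < N" "Suc k < N"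
    using exp_le N_eq step(2) L_less by linarith+
  note facts = k packs_zero exec_simps
  define T1 where "T1 = T + 4 * (L - Suc k) + 1"
  have "halts w b I (Some (3, mem 0 0 n k 0 (2 ^ k) 0 n 0 (replicate c 0), [])) (T1 + 4) out'"
    apply ((rule mem_step[where X = "{}"], (simp add: facts; fail), simp add: facts)+)[1]
    using step.IH by (simp add: mult_2 T1_def)
  then show ?case by (rule halts_mono) (use step(2) in \<open>simp add: T1_def\<close>)
qed

text \<open>The root is vertex 0: the 1 stored in cell 9 is its visited bit, and the two zeros
  written are \<open>Visit 0\<close>. Three instructions precede the loop and three follow
  it.\<close>

lemma runs_init:
  assumes next_: "runs 10 0 0 n {0} [0, 0] T out'"
  shows "halts w b I (Some (0, replicate (9 + c) 0, [])) (T + 4 * L + 7) out'"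
proof -
  have l: "2 ^ L < N" using exp_le N_eq by linarith
  have c: "0 < c" using c_eq by simp
  then have ne: "replicate c (0::nat) \<noteq> []" by simp
  define A where "A = (replicate c 0)[0 := Suc 0]"
  have A: "packs L A {0}" "length A = c"
    using packs_insert[OF packs_zero, of 0 L c] L_pos c by (auto simp: A_def)
  note facts = l packs_zero exec_simps c ne A A_def[symmetric]
  have "halts w b I (Some (7, mem 0 0 n L 0 (2 ^ L) 0 n 0 (replicate c 0), [])) (T + 3) out'"
    apply (rule mem_step[where X = "{}"], (simp add: facts; fail), simp add: facts)
    apply ((rule mem_step[where X = "{0}"], (simp add: facts; fail), simp add: facts)+)[1]
    apply (rule runsD[OF next_], simp_all add: facts)
    done
  note loop = init_loop[OF _ this, of 0]
  define T1 where "T1 = T + 4 * L + 4"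
  have 3: "halts w b I (Some (Suc (Suc (Suc 0)), mem 0 0 n 0 0 (Suc 0) 0 n 0 (replicate c 0), [])) T1 out'"
    using loop by (auto simp: T1_def numeral_3_eq_3 intro: halts_mono)
  have "halts w b I (Some (0, mem 0 0 0 0 0 0 0 0 0 (replicate c 0), [])) (T1 + 3) out'"
    apply ((rule mem_step[where X = "{}"], (simp add: facts; fail), simp add: facts)+)[1]
    apply (rule 3)
    done
  moreover have "mem 0 0 0 0 0 0 0 0 0 (replicate c 0) = replicate (9 + c) 0"
    by (simp add: mem_def eval_nat_numeral)
  moreover have "T1 + 3 = T + 4 * L + 7" by (simp add: T1_def)
  ultimately show ?thesis by simp
qed

section \<open>The traversal\<close>

text \<open>In \<open>stack S p s Y k\<close> the path \<open>p\<close> (deepest vertex first) is encoded by the ones at the bit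
  positions \<open>Y\<close> below the stack pointer \<open>s\<close>. For every vertex below the top, the part of its list up to
  the branch that was taken lies in \<open>S\<close>; \<open>k\<close> counts the entries still to be scanned in these lists
  plus the cost of all pops.\<close>

inductive stack :: "nat set \<Rightarrow> nat list \<Rightarrow> nat \<Rightarrow> nat set \<Rightarrow> nat \<Rightarrow> bool" for S where
  root: "stack S [u] n {} 0"
| push: "stack S (u' # p) s Y k \<Longrightarrow> i < deg u \<Longrightarrow> adj u ! i = u' \<Longrightarrow>
    \<forall>q\<le>cross u ! i. adj u' ! q \<in> S \<Longrightarrow>
    stack S (u # u' # p) (Suc (s + i)) (insert s Y) (k + (deg u' - Suc (cross u ! i)) + i + 2)"

lemma stack_mono: "stack S p s Y k \<Longrightarrow> S \<subseteq> S' \<Longrightarrow> stack S' p s Y k"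
proof (induction rule: stack.induct)
  case (push u' p s Y k i u)
  then show ?case by (intro stack.push) auto
qed (rule stack.root)

text \<open>The entry of \<open>u\<close> takes \<open>i + 1\<close> bits, and
  \<open>i < deg u\<close>.\<close>

lemma stack_bounds:
  "stack S p s Y k \<Longrightarrow> n \<le> s \<and> Y \<subseteq> {n..<s} \<and> s \<le> n + sum_list (map deg p)"
  by (induction rule: stack.induct) fastforce+

lemma stack_top:
  assumes "stack S p s Y k" "distinct p" "set p \<subseteq> {..<n}"
  shows "s \<le> n + 2 * m"
proof -
  have "sum_list (map deg p) = (\<Sum>v\<in>set p. deg v)"
    using assms(2) by (simp add: sum_list_distinct_conv_sum_set)
  also have "\<dots> \<le> (\<Sum>v<n. deg v)"
    using assms(3) by (intro sum_mono2) auto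
  finally show ?thesis using stack_bounds[OF assms(1)] handshake by simp
qed

text \<open>The potential of the amortised analysis, in units of at most 30 machine steps: a new vertex \<open>v\<close>
  pays \<open>deg v\<close> for its scan and at most \<open>deg v + 1\<close> for its pop.\<close>

definition work :: "nat set \<Rightarrow> nat \<Rightarrow> nat \<Rightarrow> nat \<Rightarrow> nat" where
  "work S u p k = (\<Sum>v\<in>{..<n} - S. 2 * deg v + 3) + (deg u - p) + k"

text \<open>\<open>es\<close> is assembled from the choices of the program, by induction on the
  potential. The factor 30 covers 10 steps for a skip, 22 for a push, and \<open>9 * i + 18\<close>
  for a pop, which releases \<open>i + 2\<close> units; the 5 pays for
  \<open>runs_finish\<close>.\<close>

lemma traversal:
  assumes "stack S (u # p) s Y k" "distinct (u # p)" "set (u # p) \<subseteq> S" "S \<subseteq> {..<n}"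
    and "q \<le> deg u" "\<forall>j<q. adj u ! j \<in> S"
  shows "\<exists>es. dfs_from E (u # p) S es \<and>
    runs 10 u q s (S \<union> Y) out (30 * work S u q k + 5) (out @ concat (map event_words es))"
  using assms
proof (induction "work S u q k" arbitrary: S u p s Y k q out rule: less_induct)
  case less
  note st = less.prems(1)
  have u: "u < n" using less.prems by auto
  have pn: "set (u # p) \<subseteq> {..<n}" using less.prems by auto
  have s: "n \<le> s" "Y \<subseteq> {n..<s}" using stack_bounds[OF st] by auto
  have sm: "s \<le> n + 2 * m" using stack_top[OF st less.prems(2) pn] .
  consider "q < deg u" "adj u ! q \<in> S" | "q < deg u" "adj u ! q \<notin> S" | "q = deg u"
    using less.prems(5) by linarith
  then show ?case
  proof cases
    case 1
    have w: "work S u q k = Suc (work S u (Suc q) k)" using 1 by (simp add: work_def)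
    have "\<forall>j<Suc q. adj u ! j \<in> S" using 1 less.prems(6) by (auto simp: less_Suc_eq)
    from less.hyps[OF _ st less.prems(2-4) _ this, of out] w 1
    obtain es where es: "dfs_from E (u # p) S es"
      and r: "runs 10 u (Suc q) s (S \<union> Y) out (30 * work S u (Suc q) k + 5) (out @ concat (map event_words es))"
      by auto
    have r': "runs 10 u q s (S \<union> Y) out (30 * work S u (Suc q) k + 5 + 10) (out @ concat (map event_words es))"
      using runs_skip[OF u 1(1) _ _ r] 1 sm N_eq by simp
    show ?thesis
      by (intro exI[of _ es] conjI es runs_mono[OF r']) (simp add: w)
  next
    case 2
    define v where "v = adj u ! q"
    define i where "i = cross u ! q"
    have v: "v < n" using adj_less[OF u, of v] 2 by (simp add: v_def)
    \<comment> \<open>By the last fact, popping \<open>i\<close> will lead back to position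
      \<open>q\<close> of the parent.\<close>
    have c: "i < deg v" "adj v ! i = u" "cross v ! i = q"
      using cross_props[OF u 2(1)] cross_cross[OF u 2(1)] by (auto simp: v_def i_def)
    have scanned: "\<forall>j\<le>q. adj u ! j \<in> insert v S"
      using less.prems(6) by (auto simp: v_def le_less)
    define k' where "k' = k + (deg u - Suc q) + i + 2"
    have st': "stack (insert v S) (v # u # p) (Suc (s + i)) (insert s Y) k'"
      using stack.push[OF stack_mono[OF st] c(1,2), of "insert v S"] scanned c(3)
      by (auto simp: k'_def)
    have d: "distinct (v # u # p)" using less.prems 2 by (auto simp: v_def)
    have sub: "set (v # u # p) \<subseteq> insert v S" "insert v S \<subseteq> {..<n}" using less.prems v by auto
    \<comment> \<open>The path extended by \<open>v\<close> is still distinct, so its stack fits as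
      well; this is the room that the push needs.\<close>
    have "set (v # u # p) \<subseteq> {..<n}" using sub by blast
    from stack_top[OF st' d this] have sm': "Suc (s + i) \<le> n + 2 * m" .
    have "{..<n} - S = insert v ({..<n} - insert v S)" using v 2 by (auto simp: v_def)
    then have sum_eq: "(\<Sum>x\<in>{..<n} - S. 2 * deg x + 3) =
        (\<Sum>x\<in>insert v ({..<n} - insert v S). 2 * deg x + 3)"
      by (rule arg_cong)
    have "\<dots> = (2 * deg v + 3) + (\<Sum>x\<in>{..<n} - insert v S. 2 * deg x + 3)"
      by (rule sum.insert) auto
    \<comment> \<open>\<open>v\<close> releases \<open>2 * deg v + 3\<close>; its scan takes
      \<open>deg v\<close>, its pop \<open>i + 2 \<le> deg v + 1\<close>, and the unscanned rest of
      the list of \<open>u\<close> moves into \<open>k'\<close>.\<close>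
    with sum_eq have w: "work (insert v S) v 0 k' < work S u q k"
      using 2(1) c(1) unfolding work_def k'_def by linarith
    obtain es where es: "dfs_from E (v # u # p) (insert v S) es"
      and r: "runs 10 v 0 (Suc (s + i)) (insert v S \<union> insert s Y) (out @ [0, v])
        (30 * work (insert v S) v 0 k' + 5) ((out @ [0, v]) @ concat (map event_words es))"
      using less.hyps[OF w st' d sub, of "out @ [0, v]"] by auto
    have X: "insert v S \<union> insert s Y = insert s (insert v (S \<union> Y))" by auto
    \<comment> \<open>Visited bits lie below \<open>n\<close>, stack bits between \<open>n\<close>
      and \<open>s\<close>.\<close>
    have new: "v \<notin> S \<union> Y" "s \<notin> S \<union> Y" using 2 v s less.prems(4) by (auto simp: v_def)
    have r': "runs 10 u q s (S \<union> Y) out (30 * work (insert v S) v 0 k' + 5 + 22)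
        ((out @ [0, v]) @ concat (map event_words es))"
      by (rule runs_tree[OF u 2(1), folded v_def i_def])
        (use r[unfolded X] s sm' new in simp_all)
    have "{u, v} \<in> E" using adj_props(2)[OF u] 2(1) nth_mem[of q "adj u"] by (simp add: v_def)
    then have "dfs_from E (u # p) S (Visit v # es)"
      using es 2(2) by (auto simp: v_def intro: dfs_from.advance)
    moreover have "runs 10 u q s (S \<union> Y) out (30 * work S u q k + 5)
        (out @ concat (map event_words (Visit v # es)))"
      using runs_mono[OF r', of "30 * work S u q k + 5"] w by simp
    ultimately show ?thesis by blast
  next
    case 3
    have closed: "v \<in> S" if "{u, v} \<in> E" for v
    proof -
      have "v \<in> set (adj u)" using that adj_props(2)[OF u] by simp
      then show ?thesis using less.prems(6) 3 by (auto simp: in_set_conv_nth)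
    qed
    from st show ?thesis
    proof cases
      case root
      have "dfs_from E (u # p) S [Leave u]"
        using closed root by (auto intro!: dfs_from.intros)
      moreover have "runs 10 u q s (S \<union> Y) out (30 * work S u q k + 5)
          (out @ concat (map event_words [Leave u]))"
        using runs_mono[OF runs_finish[OF u, of S out]] root 3 by simp
      ultimately show ?thesis by blast
    next
      case (push u' p' s0 Y0 k0 i)
      have i: "i < deg u" "adj u ! i = u'" using push by auto
      have u': "u' < n" using push less.prems by auto
      define j where "j = Suc (cross u ! i)"
      have j: "j \<le> deg u'" using cross_props(1)[OF u i(1)] i by (simp add: j_def)
      \<comment> \<open>Popping turns the suspended scan of \<open>u'\<close> back into the current
        one and frees \<open>i + 2\<close> units.\<close>
      have k: "k = k0 + (deg u' - j) + i + 2" using push by (simp add: j_def)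
      have w: "work S u q k = work S u' j k0 + i + 2" using 3 k by (simp add: work_def)
      have s0: "n \<le> s0" "Y0 \<subseteq> {n..<s0}" using stack_bounds push by auto
      have st': "stack S (u' # p') s0 Y0 k0" "distinct (u' # p')" "set (u' # p') \<subseteq> S"
        using push less.prems(2,3) by auto
      have scanned: "\<forall>q<j. adj u' ! q \<in> S" using push by (auto simp: j_def)
      have "work S u' j k0 < work S u q k" using w by simp
      from less.hyps[OF this st' less.prems(4) j scanned, of "out @ [1, u]"]
      obtain es where es: "dfs_from E (u' # p') S es"
        and r: "runs 10 u' j s0 (S \<union> Y0) (out @ [1, u]) (30 * work S u' j k0 + 5)
          ((out @ [1, u]) @ concat (map event_words es))"
        by blast
      have X: "S \<union> Y - {s0} = S \<union> Y0" using push s0 less.prems(4) by auto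
      \<comment> \<open>Older entries lie below \<open>s0\<close>, so \<open>s0\<close> is the
        topmost one and exactly \<open>i\<close> zeros follow it.\<close>
      have "\<forall>r. s0 < r \<and> r \<le> s0 + i \<longrightarrow> r \<notin> S \<union> Y"
      proof (intro allI impI)
        fix r assume r: "s0 < r \<and> r \<le> s0 + i"
        then have "r \<notin> S" using s0(1) less.prems(4) by auto
        moreover have "r \<notin> Y" using r push(3) s0(2) by auto
        ultimately show "r \<notin> S \<union> Y" by simp
      qed
      then have r': "runs 10 u (deg u) (Suc (s0 + i)) (S \<union> Y) out (30 * work S u' j k0 + 5 + 9 * i + 18)
          ((out @ [1, u]) @ concat (map event_words es))"
        by (intro runs_retreat[OF u i(1) s0(1)])
          (use r sm push(2,3) X i(2) in \<open>simp_all add: j_def\<close>)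
      have "dfs_from E (u # p) S (Leave u # es)"
        using closed es push by (auto intro: dfs_from.retreat)
      moreover have "runs 10 u q s (S \<union> Y) out (30 * work S u q k + 5)
          (out @ concat (map event_words (Leave u # es)))"
        using runs_mono[OF r', of "30 * work S u q k + 5"] w push(2) 3 by simp
      ultimately show ?thesis by blast
    qed
  qed
qed

section \<open>Total time and space\<close>

lemma dfs_prog_correct:
  "\<exists>es t. dfs_traversal n E es \<and> t \<le> 140 * (n + m) \<and>
     run w b I dfs_prog (0, replicate (9 + c) 0, []) t (concat (map event_words es))"
proof -
  have "\<exists>es. dfs_from E [0] {0} es \<and>
    runs 10 0 0 n ({0} \<union> {}) [0, 0] (30 * work {0} 0 0 0 + 5) ([0, 0] @ concat (map event_words es))"
    using n_pos by (intro traversal stack.root) auto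
  then obtain es where es: "dfs_from E [0] {0} es"
    and r: "runs 10 0 0 n {0} [0, 0] (30 * work {0} 0 0 0 + 5) ([0, 0] @ concat (map event_words es))"
    by auto
  have tr: "dfs_traversal n E (Visit 0 # es)"
    using es n_pos by (auto simp: dfs_traversal_def)
  have "(\<Sum>v\<in>{..<n} - {0}. 2 * deg v + 3) \<le> (\<Sum>v<n. 2 * deg v + 3)"
    by (rule sum_mono2) auto
  also have "\<dots> = 4 * m + 3 * n"
    using handshake by (simp add: sum.distrib sum_distrib_left[symmetric])
  finally have "work {0} 0 0 0 \<le> 4 * m + 4 * n"
    using deg_less[OF n_pos] by (simp add: work_def)
  moreover have "L \<le> 2 * n" using exp_le less_exp[of L] by linarith
  \<comment> \<open>The potential costs \<open>120 * (n + m)\<close>, \<open>4 * L\<close> at most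
    \<open>8 * n\<close>, and the constant 12 at most \<open>12 * n\<close>.\<close>
  ultimately have le: "30 * work {0} 0 0 0 + 5 + 4 * L + 7 \<le> 140 * (n + m)"
    using n_pos by simp
  show ?thesis
    using halts_mono[OF runs_init[OF r] le] tr
    by (intro exI[of _ "Visit 0 # es"]) (auto simp: halts_def)
qed

end

theorem theorem16:
  shows "\<exists>(P :: instr list) (K :: nat) (T :: nat \<Rightarrow> real) (f :: nat \<Rightarrow> real).
    T \<in> O(\<lambda>k. real k) \<and> f \<in> o(\<lambda>k. real k) \<and>
    (\<forall>(n :: nat) (E :: nat set set) (m :: nat) (I :: input) (w :: nat).
       simple_graph n E \<longrightarrow> connected_graph n E \<longrightarrow> m = card E \<longrightarrow> represents I n E \<longrightarrow>
       K * (n + m) \<le> 2 ^ w \<longrightarrow>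
       (\<exists>es. dfs_traversal n E es \<and>
          computes_within P w I (concat (map event_words es))
            (T (n + m)) (4 * real m + (log 2 3 + 2) * real n + f (n + m))))"
proof -
  define T :: "nat \<Rightarrow> real" where "T = (\<lambda>k. 140 * real k)"
  \<comment> \<open>The logarithm and the constant pay for ten cells, nine registers and one from
    rounding; the quotient pays for the four bits by which a cell exceeds
    \<open>2 * L\<close>.\<close>
  define f :: "nat \<Rightarrow> real" where
    "f = (\<lambda>k. 20 * log 2 (real k + 1) + 60 + 16 * real k / log 2 (real k + 1))"
  have T: "T \<in> O(\<lambda>k. real k)" unfolding T_def by real_asymp
  have f: "f \<in> o(\<lambda>k. real k)" unfolding f_def by real_asymp
  have main: "\<exists>es. dfs_traversal n E es \<and>
      computes_within dfs_prog w I (concat (map event_words es))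
        (T (n + m)) (4 * real m + (log 2 3 + 2) * real n + f (n + m))"
    if simple: "simple_graph n E" and conn: "connected_graph n E" and m: "m = card E"
      and rep: "represents I n E" and w: "16 * (n + m) \<le> 2 ^ w"
    for n m :: nat and E I w
  proof -
    have n: "0 < n" using conn by (simp add: connected_graph_def)
    interpret graph_input n m E I
      using rep simple n m by unfold_locales
    obtain L' where L': "2 ^ L' \<le> n" "n < 2 ^ (L' + 1)"
      using ex_power_ivl1[of 2 n] n by auto
    \<comment> \<open>The bit length of \<open>n\<close>, which is the value that the program
      computes in cell 3.\<close>
    define L where "L = L' + 1"
    define b where "b = 2 * L + 4"
    define c where "c = (n + 2 * m) div L + 1"
    have L: "0 < L" "n < 2 ^ L" "2 ^ L \<le> 2 * n" using L' by (auto simp: L_def)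
    have "(n + 1) * (n + 1) \<le> 2 ^ L * 2 ^ L" using L by (intro mult_mono) auto
    then have nL: "(n + 1) * (n + 1) \<le> 2 ^ (2 * L)" by (simp add: mult_2 power_add)
    \<comment> \<open>The four extra bits of \<open>b\<close> supply the factor 16.\<close>
    have "2 * n + 2 * m + 10 \<le> 16 * ((n + 1) * (n + 1))"
      using edges_le by (simp add: algebra_simps)
    also have "\<dots> \<le> 2 ^ b" using nL by (simp add: b_def power_add)
    finally have Nb: "2 * n + 2 * m + 10 \<le> 2 ^ b" .
    \<comment> \<open>The choice of 16 for \<open>K\<close> gives \<open>N \<le> 2 ^ w\<close>,
      since \<open>n \<ge> 1\<close>.\<close>
    interpret dfs_machine n m E I w b L c "2 * n + 2 * m + 10"
      using L n w Nb by unfold_locales (auto simp: c_def)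
    obtain es t where es: "dfs_traversal n E es" "t \<le> 140 * (n + m)"
      "run w b I dfs_prog (0, replicate (9 + c) 0, []) t (concat (map event_words es))"
      using dfs_prog_correct by blast
    have "real t \<le> T (n + m)" using es(2) by (simp add: T_def)
    moreover have "real ((9 + c) * b) \<le> 4 * real m + (log 2 3 + 2) * real n + f (n + m)"
    proof -
      define x where "x = log 2 (real (n + m) + 1)"
      have x0: "0 < x" using n by (simp add: x_def)
      have "real L' \<le> log 2 n" using L'(1) n by (simp add: le_log2_of_power)
      also have "\<dots> \<le> x" using n by (simp add: x_def)
      finally have Lx: "real L \<le> x + 1" by (simp add: L_def)
      \<comment> \<open>\<open>L\<close> also occurs as a divisor, so it must be bounded from below
        by the logarithm of \<open>n + m + 1\<close>.\<close>
      have "n + m + 1 \<le> (n + 1) * (n + 1)" using edges_le by (simp add: algebra_simps)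
      then have "n + m + 1 \<le> 2 ^ (2 * L)" using nL by linarith
      then have "real (n + m) + 1 \<le> 2 ^ (2 * L)"
        by (metis of_nat_1 of_nat_add of_nat_le_iff of_nat_numeral of_nat_power)
      then have "x \<le> log 2 (2 ^ (2 * L))"
        unfolding x_def by (intro log_mono) auto
      then have xL: "x \<le> 2 * real L" by (simp add: log_nat_power)
      have "real ((n + 2 * m) div L) \<le> real (n + 2 * m) / real L"
        by (rule of_nat_div_le_of_nat)
      then have "real (9 + c) \<le> real (n + 2 * m) / real L + 10" by (simp add: c_def)
      then have "real ((9 + c) * b) \<le> (real (n + 2 * m) / real L + 10) * (2 * real L + 4)"
        unfolding of_nat_mult by (rule mult_mono) (auto simp: b_def)
      also have "\<dots> = 2 * real (n + 2 * m) + 20 * real L + 40 + 4 * (real (n + 2 * m) / real L)"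
        using L(1) by (simp add: field_simps)
      also have "real (n + 2 * m) / real L \<le> (2 * real (n + m)) / (x / 2)"
        using x0 xL by (intro frac_le) auto
      finally have "real ((9 + c) * b) \<le> 2 * real (n + 2 * m) + 20 * (x + 1) + 40 + 16 * real (n + m) / x"
        using Lx by simp
      \<comment> \<open>The leading terms are \<open>4 * m + 2 * n\<close>; the summand
        \<open>log 2 3 * n\<close> is slack.\<close>
      also have "\<dots> \<le> 4 * real m + (log 2 3 + 2) * real n + f (n + m)"
        by (simp add: f_def x_def algebra_simps)
      finally show ?thesis .
    qed
    ultimately show ?thesis using es unfolding computes_within_def by blast
  qed
  show ?thesis
    by (intro exI[of _ dfs_prog] exI[of _ 16] exI[of _ T] exI[of _ f] conjI T f allI impI) (rule main)
qed

end
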